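(* Let $d\in\mathbb{N}$ and let $p_1,\ldots,p_d$ be integral polynomials with $p_i(0)=0$ for $1\le i\le d$. If $S\subseteq\mathbb{Z}$ is thickly syndetic in $\mathbb{Z}$, then $$\{(m,n)\in\mathbb{Z}^2: m+p_1(n),\,m+p_2(n),\ldots,\,m+p_d(n)\in S\}$$ is thickly syndetic in $\mathbb{Z}^2$.
   Context: An integral polynomial is a polynomial $p$ (with rational coefficients) with $p(\mathbb{Z})\subseteq\mathbb{Z}$. A subset of $\mathbb{Z}$ is syndetic if it has bounded gaps (finitely many translates cover $\mathbb{Z}$); a subset of $\mathbb{Z}^2$ is syndetic if finitely many of its translates cover $\mathbb{Z}^2$. A set $S\subseteq\mathbb{Z}$ is thickly syndetic if for every $N\in\mathbb{N}$ the set $\{a\in\mathbb{Z}:\{a,a+1,\ldots,a+N-1\}\subseteq S\}$ is syndetic in $\mathbb{Z}$. A set $F\subseteq\mathbb{Z}^2$ is thickly syndetic if for all $M,N\in\mathbb{N}$ the set $\{(a,b)\in\mathbb{Z}^2:\{a,\ldots,a+M-1\}\times\{b,\ldots,b+N-1\}\subseteq F\}$ is syndetic in $\mathbb{Z}^2$. *)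

theory Defs
  imports "HOL-Computational_Algebra.Polynomial" "HOL-Library.Product_Plus"
begin

definition integral_poly :: "rat poly \<Rightarrow> bool" where
  "integral_poly p \<longleftrightarrow> (\<forall>n::int. poly p (of_int n) \<in> \<int>)"

(* Used both for int and, with the componentwise addition of Product_Plus, for int \<times> int. *)
definition syndetic :: "'a::ab_group_add set \<Rightarrow> bool" where
  "syndetic A \<longleftrightarrow> (\<exists>F. finite F \<and> (\<Union>t\<in>F. (+) t ` A) = UNIV)"

definition thickly_syndetic :: "int set \<Rightarrow> bool" where
  "thickly_syndetic S \<longleftrightarrow> (\<forall>N::nat. syndetic {a. {a..a + int N - 1} \<subseteq> S})"

definition thickly_syndetic2 :: "(int \<times> int) set \<Rightarrow> bool" where
  "thickly_syndetic2 F \<longleftrightarrow>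
     (\<forall>M N::nat. syndetic {(a, b). {a..a + int M - 1} \<times> {b..b + int N - 1} \<subseteq> F})"

end

theory Submission
  imports Defs
begin

text \<open>
  Thickly syndetic sets are closed under finite intersections, and the gap bounds for an
  intersection of translates of one such set are uniform: they depend on the number of translates
  but not on the translating elements. Fix block sizes \<open>M\<close>, \<open>N\<close> and a base point \<open>(a, b)\<close>, and
  look for a good point \<open>(c, b)\<close> in the same row. The \<open>M\<close> by \<open>N\<close> box with corner \<open>(c, b)\<close> consists
  of points of the required kind exactly if, for each of the \<open>d * N\<close> integers \<open>p\<^sub>i (b + j)\<close> with
  \<open>0 \<le> j < N\<close>, the block of length \<open>M\<close> starting at \<open>c + p\<^sub>i (b + j)\<close> lies in \<open>S\<close>. These shifts
  depend on \<open>b\<close>, but their number does not, so by \<open>thickly_syndetic_common_block\<close> a suitable \<open>c\<close>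
  exists within a distance of \<open>a\<close> that is bounded uniformly in \<open>a\<close> and \<open>b\<close>. Hence finitely many
  horizontal translates of the good points cover the plane.
\<close>

text \<open>A covering by translates by elements of absolute value at most \<open>B\<close>, read off at the
  point \<open>x + B\<close>, provides an element between \<open>x\<close> and \<open>x + 2 * B\<close>.\<close>

lemma syndetic_int_bounded_gaps:
  fixes A :: "int set"
  assumes "syndetic A"
  obtains L :: nat where "\<And>x. \<exists>a\<in>A. x \<le> a \<and> a \<le> x + int L"
proof -
  obtain F where F: "finite F" "(\<Union>t\<in>F. (+) t ` A) = UNIV"
    using assms unfolding syndetic_def by blast
  obtain B where B: "\<And>t. t \<in> F \<Longrightarrow> \<bar>t\<bar> \<le> B" "0 \<le> B"
  proof
    show "\<bar>t\<bar> \<le> (\<Sum>s\<in>F. \<bar>s\<bar>)" if "t \<in> F" for t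
      using that F(1) by (intro member_le_sum) auto
  qed (simp add: sum_nonneg)
  have "\<exists>a\<in>A. x \<le> a \<and> a \<le> x + int (nat (2 * B))" for x
  proof -
    have "x + B \<in> (\<Union>t\<in>F. (+) t ` A)"
      using F(2) by simp
    then obtain t a where ta: "t \<in> F" "a \<in> A" "x + B = t + a"
      by blast
    have "x \<le> a \<and> a \<le> x + int (nat (2 * B))"
      using B(1)[OF ta(1)] B(2) ta(3) by linarith
    with ta(2) show ?thesis
      by blast
  qed
  then show thesis
    by (rule that)
qed

text \<open>Induction on the number of shifts. To accommodate one more shift \<open>k\<close>, the other shifts are
  first served with blocks longer than required by the gap bound \<open>L\<^sub>1\<close> for blocks of length \<open>M\<close> in
  \<open>S\<close>. The start can then still be moved by up to \<open>L\<^sub>1\<close> without leaving these longer blocks, which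
  is enough freedom to serve \<open>k\<close>. The bound depends only on the index set because it is chosen
  before the shifts \<open>f\<close>.\<close>

lemma thickly_syndetic_common_block:
  fixes S :: "int set" and K :: "'k set" and M :: nat
  assumes S: "thickly_syndetic S" and "finite K"
  shows "\<exists>L::nat. \<forall>(f :: 'k \<Rightarrow> int) x. \<exists>a. x \<le> a \<and> a \<le> x + int L \<and>
           (\<forall>k\<in>K. {a + f k..a + f k + int M - 1} \<subseteq> S)"
  using assms(2)
proof (induction K arbitrary: M rule: finite_induct)
  case empty
  show ?case
    by (intro exI[of _ 0]) auto
next
  case (insert k K)
  have "syndetic {a. {a..a + int M - 1} \<subseteq> S}"
    using S unfolding thickly_syndetic_def by blast
  then obtain L\<^sub>1 where
    L\<^sub>1: "\<And>x. \<exists>a\<in>{a. {a..a + int M - 1} \<subseteq> S}. x \<le> a \<and> a \<le> x + int L\<^sub>1"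
    by (rule syndetic_int_bounded_gaps) (rule that)
  obtain L\<^sub>2 :: nat where L\<^sub>2: "\<And>(f :: 'k \<Rightarrow> int) x. \<exists>a. x \<le> a \<and> a \<le> x + int L\<^sub>2 \<and>
      (\<forall>k\<in>K. {a + f k..a + f k + int (M + L\<^sub>1) - 1} \<subseteq> S)"
    using insert.IH[of "M + L\<^sub>1"] by blast
  have "\<exists>a. x \<le> a \<and> a \<le> x + int (L\<^sub>2 + L\<^sub>1) \<and>
      (\<forall>k\<in>insert k K. {a + f k..a + f k + int M - 1} \<subseteq> S)" for f :: "'k \<Rightarrow> int" and x
  proof -
    obtain y where y: "x \<le> y" "y \<le> x + int L\<^sub>2"
      "\<And>k. k \<in> K \<Longrightarrow> {y + f k..y + f k + int (M + L\<^sub>1) - 1} \<subseteq> S"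
      using L\<^sub>2[of x f] by blast
    obtain z where z: "{z..z + int M - 1} \<subseteq> S" "y + f k \<le> z" "z \<le> y + f k + int L\<^sub>1"
      using L\<^sub>1[of "y + f k"] by blast
    define a where "a = z - f k"
    have a: "y \<le> a" "a \<le> y + int L\<^sub>1"
      using z(2,3) unfolding a_def by linarith+
    have "{a + f i..a + f i + int M - 1} \<subseteq> S" if "i \<in> K" for i
    proof -
      have "{a + f i..a + f i + int M - 1} \<subseteq> {y + f i..y + f i + int (M + L\<^sub>1) - 1}"
        using a by auto
      with y(3)[OF that] show ?thesis
        by (rule order_trans[rotated])
    qed
    moreover have "{a + f k..a + f k + int M - 1} \<subseteq> S"
      using z(1) unfolding a_def by simp
    ultimately show ?thesis
      using a y(1,2) by (intro exI[of _ a]) auto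
  qed
  then show ?case
    by blast
qed

lemma syndetic_if_bounded_row_gaps:
  fixes A :: "(int \<times> int) set"
  assumes "\<And>a b. \<exists>c. a \<le> c \<and> c \<le> a + int L \<and> (c, b) \<in> A"
  shows "syndetic A"
  unfolding syndetic_def
proof (intro exI conjI)
  show "finite ((\<lambda>l. (- l, 0 :: int)) ` {0..int L})"
    by simp
  show "(\<Union>t\<in>(\<lambda>l. (- l, 0 :: int)) ` {0..int L}. (+) t ` A) = UNIV"
  proof (intro set_eqI iffI UNIV_I)
    fix v :: "int \<times> int"
    obtain a b where v: "v = (a, b)"
      by fastforce
    obtain c where c: "a \<le> c" "c \<le> a + int L" "(c, b) \<in> A"
      using assms by blast
    have "v = (- (c - a), 0) + (c, b)"
      using v by simp
    moreover have "c - a \<in> {0..int L}"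
      using c by simp
    ultimately show "v \<in> (\<Union>t\<in>(\<lambda>l. (- l, 0 :: int)) ` {0..int L}. (+) t ` A)"
      using c(3) by blast
  qed
qed

text \<open>In row \<open>b\<close> the shifts are the values \<open>q i (b + j)\<close>, indexed by pairs \<open>(i, j)\<close> from a set
  that does not depend on \<open>b\<close>; this is why a single bound \<open>L\<close> serves all rows at once, however
  fast the functions \<open>q i\<close> grow.\<close>

lemma thickly_syndetic2_shifts:
  fixes S :: "int set" and I :: "'i set" and q :: "'i \<Rightarrow> int \<Rightarrow> int"
  assumes S: "thickly_syndetic S" and I: "finite I"
  shows "thickly_syndetic2 {(m, n). \<forall>i\<in>I. m + q i n \<in> S}"
  unfolding thickly_syndetic2_def
proof (intro allI)
  fix M N :: nat
  let ?F = "{(m, n). \<forall>i\<in>I. m + q i n \<in> S}"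
  let ?K = "I \<times> {0..int N - 1}"
  obtain L :: nat where L: "\<And>(f :: 'i \<times> int \<Rightarrow> int) x. \<exists>a. x \<le> a \<and> a \<le> x + int L \<and>
      (\<forall>k\<in>?K. {a + f k..a + f k + int M - 1} \<subseteq> S)"
    using thickly_syndetic_common_block[OF S, of ?K M] I by blast
  show "syndetic {(a, b). {a..a + int M - 1} \<times> {b..b + int N - 1} \<subseteq> ?F}"
  proof (rule syndetic_if_bounded_row_gaps)
    fix a b :: int
    obtain c where c: "a \<le> c" "c \<le> a + int L"
      "\<And>i j. i \<in> I \<Longrightarrow> j \<in> {0..int N - 1} \<Longrightarrow>
         {c + q i (b + j)..c + q i (b + j) + int M - 1} \<subseteq> S"
      using L[of a "\<lambda>(i, j). q i (b + j)"] by fastforce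
    have "m + q i n \<in> S"
      if "m \<in> {c..c + int M - 1}" "n \<in> {b..b + int N - 1}" "i \<in> I" for m n i
      using c(3)[OF that(3), of "n - b"] that(1,2) by auto
    then show "\<exists>c. a \<le> c \<and> c \<le> a + int L \<and>
        (c, b) \<in> {(a, b). {a..a + int M - 1} \<times> {b..b + int N - 1} \<subseteq> ?F}"
      using c(1,2) by (intro exI[of _ c]) auto
  qed
qed

theorem theoremB:
  fixes d :: nat and p :: "nat \<Rightarrow> rat poly" and S :: "int set"
  assumes "\<And>i. i \<in> {1..d} \<Longrightarrow> integral_poly (p i)"
    and "\<And>i. i \<in> {1..d} \<Longrightarrow> poly (p i) 0 = 0"
    and "thickly_syndetic S"
  shows "thickly_syndetic2
    {(m, n). \<forall>i\<in>{1..d}. rat_of_int m + poly (p i) (rat_of_int n) \<in> rat_of_int ` S}"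
proof -
  define q where "q = (\<lambda>i n. \<lfloor>poly (p i) (rat_of_int n)\<rfloor>)"
  have q: "poly (p i) (rat_of_int n) = rat_of_int (q i n)" if "i \<in> {1..d}" for i n
    using assms(1)[OF that] unfolding integral_poly_def q_def by simp
  have "rat_of_int m + poly (p i) (rat_of_int n) \<in> rat_of_int ` S \<longleftrightarrow> m + q i n \<in> S"
    if "i \<in> {1..d}" for i m n
  proof -
    have "rat_of_int m + poly (p i) (rat_of_int n) = rat_of_int (m + q i n)"
      using q[OF that] by simp
    then show ?thesis
      by (auto simp del: of_int_add)
  qed
  then have "{(m, n). \<forall>i\<in>{1..d}. rat_of_int m + poly (p i) (rat_of_int n) \<in> rat_of_int ` S} =
      {(m, n). \<forall>i\<in>{1..d}. m + q i n \<in> S}"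
    by auto
  then show ?thesis
    using thickly_syndetic2_shifts[OF assms(3), of "{1..d}" q] by simp
qed

end
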